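(* Let $G_1$ and $G_2$ be unicyclic graphs, each containing a perfect matching, with $m_{G_1}(2)=m_{G_2}(2)=2$. Let $C_{g_1}$ and $C_{g_2}$ denote the unique cycles of $G_1$ and $G_2$, respectively, and let $u\in V(C_{g_1})$ and $v\in V(C_{g_2})$. Then $m_{G_1\odot_{uv}G_2}(2)=3$.
   Context: All graphs are finite, undirected, without loops or multiple edges. The Laplacian matrix of a graph $G$ is $L(G)=D(G)-A(G)$, where $D(G)$ is the diagonal matrix of vertex degrees and $A(G)$ is the adjacency matrix; $m_G(\lambda)$ denotes the multiplicity of $\lambda$ as an eigenvalue of $L(G)$. A unicyclic graph is a connected graph whose number of edges equals its number of vertices (so it has exactly one cycle). For graphs $G_1,G_2$ with disjoint vertex sets, $u\in V(G_1)$ and $v\in V(G_2)$, the one-edge connection $G_1\odot_{uv}G_2$ is the graph with vertex set $V(G_1)\cup V(G_2)$ and edge set $E(G_1)\cup E(G_2)\cup\{uv\}$. *)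

theory Defs
  imports "HOL-Analysis.Analysis"
begin

text \<open>
  A graph is given by its set of edges; its vertex set is the whole (finite) type \<open>'v\<close>.
\<close>

type_synonym 'v graph = "'v set set"

definition simple_graph :: "'v::finite graph \<Rightarrow> bool" where
  "simple_graph G \<longleftrightarrow> (\<forall>e\<in>G. card e = 2)"

definition adj :: "'v graph \<Rightarrow> ('v \<times> 'v) set" where
  "adj G = {(x, y). {x, y} \<in> G}"

definition connected_graph :: "'v graph \<Rightarrow> bool" where
  "connected_graph G \<longleftrightarrow> (\<forall>x y. (x, y) \<in> (adj G)\<^sup>*)"

definition unicyclic :: "'v::finite graph \<Rightarrow> bool" where
  "unicyclic G \<longleftrightarrow> simple_graph G \<and> connected_graph G \<and> card G = CARD('v)"

definition perfect_matching :: "'v graph \<Rightarrow> 'v graph \<Rightarrow> bool" where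
  "perfect_matching G M \<longleftrightarrow> M \<subseteq> G \<and> (\<forall>x. \<exists>!e. e \<in> M \<and> x \<in> e)"

text \<open>
  A cycle is represented by its vertices in cyclic order; the list representing a given
  cycle is unique only up to rotation and reversal.
\<close>

definition is_cycle :: "'v graph \<Rightarrow> 'v list \<Rightarrow> bool" where
  "is_cycle G c \<longleftrightarrow> 3 \<le> length c \<and> distinct c \<and>
     (\<forall>i<length c. {c ! i, c ! (Suc i mod length c)} \<in> G)"

definition vertex_degree :: "'v::finite graph \<Rightarrow> 'v \<Rightarrow> nat" where
  "vertex_degree G x = card {e \<in> G. x \<in> e}"

definition degree_matrix :: "'v::finite graph \<Rightarrow> real^'v^'v" where
  "degree_matrix G = (\<chi> i j. if i = j then real (vertex_degree G i) else 0)"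

definition adjacency_matrix :: "'v::finite graph \<Rightarrow> real^'v^'v" where
  "adjacency_matrix G = (\<chi> i j. if (i, j) \<in> adj G then 1 else 0)"

definition laplacian :: "'v::finite graph \<Rightarrow> real^'v^'v" where
  "laplacian G = degree_matrix G - adjacency_matrix G"

text \<open>
  The Laplacian matrix of a simple graph is real symmetric, so the multiplicity of an
  eigenvalue is the dimension of its eigenspace (and is 0 for a non-eigenvalue).
\<close>

definition eig_mult :: "'v::finite graph \<Rightarrow> real \<Rightarrow> nat" where
  "eig_mult G l = dim {x. laplacian G *v x = l *\<^sub>R x}"

text \<open>The sum type provides the disjoint union of the two vertex sets.\<close>

definition one_edge_connection ::
  "'a graph \<Rightarrow> 'a \<Rightarrow> 'b graph \<Rightarrow> 'b \<Rightarrow> ('a + 'b) graph" where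
  "one_edge_connection G\<^sub>1 u G\<^sub>2 v =
     (\<lambda>e. Inl ` e) ` G\<^sub>1 \<union> (\<lambda>e. Inr ` e) ` G\<^sub>2 \<union> {{Inl u, Inr v}}"

lemma transpose_laplacian: "transpose (laplacian G) = laplacian G"
  by (simp add: laplacian_def degree_matrix_def adjacency_matrix_def adj_def
      transpose_def vec_eq_iff insert_commute)

lemma simple_graph_one_edge_connection:
  assumes "simple_graph G\<^sub>1" and "simple_graph G\<^sub>2"
  shows "simple_graph (one_edge_connection G\<^sub>1 u G\<^sub>2 v)"
  using assms by (auto simp: simple_graph_def one_edge_connection_def card_image)

end

theory Submission
  imports Defs
begin

text \<open>
  It suffices that some eigenvector of \<open>G\<^sub>1\<close> for the eigenvalue 2 is nonzero at \<open>u\<close>: by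
  symmetry of the Laplacian an eigenvector of the connection then takes equal values at
  \<open>u\<close> and \<open>v\<close>, so the eigenspace is the hyperplane \<open>x\<^sub>u = y\<^sub>v\<close> of the product of the two
  eigenspaces and has dimension \<open>2 + 2 - 1\<close>.

  If all eigenvectors of \<open>G\<^sub>1\<close> vanished at \<open>u\<close>, then by dimension some eigenvector \<open>x \<noteq> 0\<close>
  would also vanish at a neighbour \<open>w\<close> of \<open>u\<close> on the cycle. Deleting the edge \<open>uw\<close> leaves a
  tree. Each tree edge \<open>ab\<close> is a bridge; summing \<open>Lx = 2x\<close> over the side \<open>S\<close> containing \<open>a\<close>
  gives \<open>x\<^sub>a - x\<^sub>b = 2 \<Sum>\<^sub>S x\<close>. Following paths from \<open>u\<close>, where \<open>x\<close> vanishes, we get \<open>x = 2Nx\<close>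
  for an integer matrix \<open>N\<close>, which is impossible since \<open>det (1 - 2N)\<close> is odd.
\<close>

section \<open>Integer matrices congruent to the identity modulo 2\<close>

text \<open>In the Leibniz expansion every permutation other than the identity moves some index and
  so picks up an even factor; modulo 2 only the diagonal product is left.\<close>

lemma odd_det:
  fixes A :: "int^'n^'n"
  assumes diag: "\<And>i. odd (A $ i $ i)" and offdiag: "\<And>i j. i \<noteq> j \<Longrightarrow> even (A $ i $ j)"
  shows "odd (det A)"
proof -
  let ?P = "{p. p permutes (UNIV :: 'n set)}"
  let ?t = "\<lambda>p. of_int (sign p) * (\<Prod>i\<in>UNIV. A $ i $ p i)"
  have fin: "finite ?P"
    by (simp add: finite_permutations)
  have "even (?t p)" if "p \<in> ?P - {id}" for p
  proof -
    obtain i where "p i \<noteq> i"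
      using \<open>p \<in> ?P - {id}\<close> by fastforce
    then have "even (A $ i $ p i)"
      by (metis offdiag)
    then show ?thesis
      by (metis UNIV_I dvd_mult dvd_prodI dvd_trans finite)
  qed
  then have "even (\<Sum>p\<in>?P - {id}. ?t p)"
    by (rule dvd_sum)
  moreover have "odd (?t id)"
    using diag by (simp add: even_prod_iff)
  moreover have "det A = ?t id + (\<Sum>p\<in>?P - {id}. ?t p)"
    unfolding det_def by (rule sum.remove[OF fin]) simp
  ultimately show ?thesis
    by simp
qed

lemma det_map_matrix_of_int:
  "det (map_matrix of_int A :: 'a::comm_ring_1^'n^'n) = of_int (det A)"
  by (simp add: det_def)

text \<open>\<open>x\<close> lies in the kernel of 1 - 2N. The determinant is taken over the
  integers, where parity makes sense, and carried to the reals by \<open>of_int\<close>: odd, hence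
  nonzero.\<close>

lemma eq_zero_if_eq_double_integer_combination:
  fixes x :: "real^'n" and N :: "'n \<Rightarrow> 'n \<Rightarrow> int"
  assumes x: "\<And>i. x $ i = 2 * (\<Sum>j\<in>UNIV. of_int (N i j) * x $ j)"
  shows "x = 0"
proof -
  define A :: "int^'n^'n" where "A = (\<chi> i j. (if i = j then 1 else 0) - 2 * N i j)"
  define B :: "real^'n^'n" where "B = map_matrix of_int A"
  have "odd (det A)"
    by (rule odd_det) (simp_all add: A_def)
  then have "det B \<noteq> 0"
    unfolding B_def det_map_matrix_of_int by auto
  then have "\<exists>C. C ** B = mat 1"
    by (meson invertible_det_nz invertible_def)
  moreover have "B *v x = 0"
  proof -
    have "(B *v x) $ i = 0" for i
    proof -
      have "(B *v x) $ i = (\<Sum>j\<in>UNIV. (if i = j then x $ j else 0) - 2 * (of_int (N i j) * x $ j))"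
        unfolding B_def A_def matrix_vector_mult_def
        by (simp, intro sum.cong) (auto simp: algebra_simps)
      also have "\<dots> = x $ i - 2 * (\<Sum>j\<in>UNIV. of_int (N i j) * x $ j)"
        by (simp add: sum_subtractf sum_distrib_left)
      finally show ?thesis
        using x[of i] by simp
    qed
    then show ?thesis
      by (simp add: vec_eq_iff)
  qed
  ultimately show ?thesis
    using matrix_left_invertible_ker by blast
qed

section \<open>Bridges and cycles\<close>

text \<open>\<open>f\<close> is a labelling constant on components; starting from distinct labels,
  each edge merges at most two of them. This gives the component count without any theory of
  trees.\<close>

lemma exists_edge_invariant_function:
  fixes F :: "'v::finite graph"
  shows "\<exists>f :: 'v \<Rightarrow> 'v. (\<forall>a b. {a, b} \<in> F \<longrightarrow> f a = f b) \<and> CARD('v) \<le> card (range f) + card F"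
proof (induction F rule: finite_induct[OF finite])
  case 1
  show ?case
    by (rule exI[of _ id]) simp
next
  case (2 e F)
  then obtain f :: "'v \<Rightarrow> 'v" where f: "\<And>a b. {a, b} \<in> F \<Longrightarrow> f a = f b"
    and card: "CARD('v) \<le> card (range f) + card F"
    by blast
  show ?case
  proof (cases "\<exists>a b. e = {a, b}")
    case False
    then show ?thesis
      using f card 2 by (intro exI[of _ f]) auto
  next
    case True
    then obtain a b where e: "e = {a, b}"
      by blast
    \<comment> \<open>Relabel the class of \<open>b\<close> by the label of \<open>a\<close>: at
      most the label \<open>f b\<close> disappears, paid for by the new edge.\<close>
    define g where "g = (\<lambda>x. if f x = f b then f a else f x)"
    have "range f - {f b} \<subseteq> range g"
      by (auto simp: g_def)
    then have "card (range f - {f b}) \<le> card (range g)"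
      by (intro card_mono) auto
    then have "card (range f) \<le> card (range g) + 1"
      using card_Diff_singleton[OF rangeI[of f b]] by linarith
    moreover have "g c = g d" if "{c, d} \<in> insert e F" for c d
      using that f[of c d] by (auto simp: e g_def doubleton_eq_iff)
    ultimately show ?thesis
      using card 2 by (intro exI[of _ g]) auto
  qed
qed

text \<open>Without \<open>{a, b}\<close> at most CARD - 2 edges remain, so a labelling of the rest
  has at least two values. Equal labels at \<open>a\<close> and \<open>b\<close> would make it
  constant by connectedness. \<open>S\<close> is the label class of \<open>a\<close>.\<close>

lemma bridge_if_connected_graph:
  fixes T :: "'v::finite graph"
  assumes "connected_graph T" and "card T < CARD('v)" and ab: "{a, b} \<in> T"
  obtains S where "a \<in> S" and "b \<notin> S"
    and "\<And>c d. {c, d} \<in> T \<Longrightarrow> c \<in> S \<Longrightarrow> d \<notin> S \<Longrightarrow> {c, d} = {a, b}"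
proof -
  obtain f :: "'v \<Rightarrow> 'v" where f: "\<And>c d. {c, d} \<in> T - {{a, b}} \<Longrightarrow> f c = f d"
    and card: "CARD('v) \<le> card (range f) + card (T - {{a, b}})"
    using exists_edge_invariant_function[of "T - {{a, b}}"] by blast
  have "f a \<noteq> f b"
  proof
    assume eq: "f a = f b"
    have edge: "f c = f d" if "{c, d} \<in> T" for c d
      using that f[of c d] eq by (cases "{c, d} = {a, b}") (auto simp: doubleton_eq_iff)
    have "f d = f a" for d
    proof -
      have "(a, d) \<in> (adj T)\<^sup>*"
        using assms(1) by (simp add: connected_graph_def)
      then show ?thesis
        by induction (auto simp: adj_def dest: edge)
    qed
    then have "range f = {f a}"
      by auto
    moreover have "card T > 0"
      using ab by (auto simp: card_gt_0_iff)
    ultimately show False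
      using card assms(2) ab by (simp add: card_Diff_singleton)
  qed
  show thesis
  proof
    show "a \<in> {x. f x = f a}" "b \<notin> {x. f x = f a}"
      using \<open>f a \<noteq> f b\<close> by auto
    show "{c, d} = {a, b}" if "{c, d} \<in> T" "c \<in> {x. f x = f a}" "d \<notin> {x. f x = f a}" for c d
      using that f[of c d] by auto
  qed
qed

lemma sym_adj: "sym (adj G)"
  by (auto simp: adj_def sym_def insert_commute)

text \<open>Each use of the deleted edge in a walk is replaced by the detour between its
  ends.\<close>

lemma connected_graph_delete_edge:
  assumes "connected_graph G" and "(w, u) \<in> (adj (G - {{u, w}}))\<^sup>*"
  shows "connected_graph (G - {{u, w}})"
proof -
  let ?R = "(adj (G - {{u, w}}))\<^sup>*"
  have uw: "(u, w) \<in> ?R"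
    using assms(2) by (meson sym_adj sym_rtrancl symD)
  have "(x, y) \<in> ?R" if "(x, y) \<in> (adj G)\<^sup>*" for x y
    using that
  proof induction
    case (step y z)
    have "(y, z) \<in> ?R"
    proof (cases "{y, z} = {u, w}")
      case True
      then show ?thesis
        using uw assms(2) by (auto simp: doubleton_eq_iff)
    next
      case False
      then show ?thesis
        using step.hyps(2) by (auto simp: adj_def)
    qed
    then show ?case
      using step.IH by (rule rtrancl_trans[rotated])
  qed simp
  then show ?thesis
    using assms(1) by (simp add: connected_graph_def)
qed

text \<open>\<open>w\<close> is the successor of \<open>u\<close> in the list, and the rest of the
  cycle leads from \<open>w\<close> back to \<open>u\<close>.\<close>

lemma is_cycle_delete_edge:
  assumes c: "is_cycle G c" and "u \<in> set c"
  obtains w where "{u, w} \<in> G" and "(w, u) \<in> (adj (G - {{u, w}}))\<^sup>*"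
proof -
  obtain i where i: "i < length c" "c ! i = u"
    using \<open>u \<in> set c\<close> by (auto simp: in_set_conv_nth)
  define n where "n = length c"
  \<comment> \<open>The cycle re-indexed to start at \<open>u\<close>, with \<open>d n = u\<close>
    closing it.\<close>
  define d where "d k = c ! ((i + k) mod n)" for k
  have n: "3 \<le> n" and dist: "distinct c"
    using c by (auto simp: is_cycle_def n_def)
  have inj: "k = l" if "d k = d l" "k < n" "l < n" for k l
  proof -
    have "(i + k) mod n = (i + l) mod n"
      using that n dist unfolding d_def n_def
      by (subst (asm) nth_eq_iff_index_eq) (auto intro!: mod_less_divisor)
    then have "k \<le> l \<Longrightarrow> n dvd l - k" "l \<le> k \<Longrightarrow> n dvd k - l"
      by (metis add_diff_cancel_left add_le_cancel_left mod_eq_dvd_iff_nat)+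
    then show ?thesis
      using that by (cases k l rule: linorder_cases) (auto dest: dvd_imp_le)
  qed
  have edge: "{d k, d (Suc k)} \<in> G" for k
  proof -
    have "(i + k) mod n < length c"
      using n by (simp add: n_def[symmetric])
    then have "{c ! ((i + k) mod n), c ! (Suc ((i + k) mod n) mod length c)} \<in> G"
      using c unfolding is_cycle_def by blast
    then show ?thesis
      by (simp add: d_def n_def mod_Suc_eq)
  qed
  have d0: "d 0 = u" and dn: "d n = u"
    using i by (simp_all add: d_def n_def)
  have path: "(d 1, d (Suc k)) \<in> (adj (G - {{u, d 1}}))\<^sup>*" if "k < n" for k
    using that
  proof (induction k)
    case (Suc k)
    \<comment> \<open>The detour avoids the deleted edge: by distinctness a repetition could only be
      that edge reversed, with k = 0 and \<open>d 2 = d 0\<close>, which length at least 3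
      excludes.\<close>
    have "{d (Suc k), d (Suc (Suc k))} \<noteq> {d 0, d 1}"
    proof
      assume "{d (Suc k), d (Suc (Suc k))} = {d 0, d 1}"
      then have *: "d (Suc k) = d 0 \<or> d (Suc k) = d 1 \<and> d (Suc (Suc k)) = d 0"
        by (auto simp: doubleton_eq_iff)
      have "d (Suc k) \<noteq> d 0"
        using inj[of "Suc k" 0] Suc.prems by auto
      with * have "k = 0" "d 2 = d 0"
        using inj[of "Suc k" 1] Suc.prems n by (auto simp: numeral_2_eq_2)
      then show False
        using inj[of 2 0] n by auto
    qed
    then have "(d (Suc k), d (Suc (Suc k))) \<in> adj (G - {{u, d 1}})"
      using edge[of "Suc k"] by (simp add: adj_def d0)
    then show ?case
      using Suc by (meson Suc_lessD rtrancl.rtrancl_into_rtrancl)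
  qed simp
  show thesis
  proof
    show "{u, d 1} \<in> G"
      using edge[of 0] d0 by simp
    show "(d 1, u) \<in> (adj (G - {{u, d 1}}))\<^sup>*"
      using path[of "n - 1"] n dn by simp
  qed
qed

section \<open>The Laplacian\<close>

lemma vertex_degree_eq_card_neighbours:
  assumes "simple_graph G"
  shows "vertex_degree G i = card {j. {i, j} \<in> G}"
proof -
  have ne: "i \<noteq> j" if "{i, j} \<in> G" for j
    using assms that by (force simp: simple_graph_def)
  have "inj_on (\<lambda>j. {i, j}) {j. {i, j} \<in> G}"
    by (auto simp: inj_on_def doubleton_eq_iff)
  moreover have "(\<lambda>j. {i, j}) ` {j. {i, j} \<in> G} = {e \<in> G. i \<in> e}"
  proof -
    have "\<exists>j. e = {i, j}" if "e \<in> G" "i \<in> e" for e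
      using that assms by (fastforce simp: simple_graph_def card_2_iff)
    then show ?thesis
      by auto
  qed
  ultimately show ?thesis
    using card_image unfolding vertex_degree_def by fastforce
qed

lemma laplacian_mult_nth:
  fixes x :: "real^'v::finite"
  assumes "simple_graph G"
  shows "(laplacian G *v x) $ i = (\<Sum>j\<in>UNIV. if {i, j} \<in> G then x $ i - x $ j else 0)"
proof -
  have loop: "{i} \<notin> G"
    using assms by (force simp: simple_graph_def)
  have "(laplacian G *v x) $ i
      = (\<Sum>j\<in>UNIV. (if i = j then real (vertex_degree G i) * x $ j else 0)
          - (if {i, j} \<in> G then x $ j else 0))"
    unfolding laplacian_def degree_matrix_def adjacency_matrix_def adj_def matrix_vector_mult_def
    using loop by (simp, intro sum.cong) auto
  also have "\<dots> = real (vertex_degree G i) * x $ i - (\<Sum>j\<in>UNIV. if {i, j} \<in> G then x $ j else 0)"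
    by (simp add: sum_subtractf)
  also have "real (vertex_degree G i) * x $ i = (\<Sum>j\<in>UNIV. if {i, j} \<in> G then x $ i else 0)"
    by (simp add: vertex_degree_eq_card_neighbours[OF assms] sum.If_cases)
  finally show ?thesis
    by (simp add: sum_subtractf[symmetric] if_distrib cong: if_cong)
qed

lemma subspace_eigenspace: "subspace {x :: real^'n. A *v x = l *\<^sub>R x}"
  by (auto simp: subspace_def algebra_simps)

lemma sum_antisymmetric:
  fixes f :: "'i \<Rightarrow> 'i \<Rightarrow> real"
  assumes "\<And>i j. f i j = - f j i"
  shows "(\<Sum>i\<in>S. \<Sum>j\<in>S. f i j) = 0"
proof -
  have "(\<Sum>i\<in>S. \<Sum>j\<in>S. f i j) = (\<Sum>j\<in>S. \<Sum>i\<in>S. - f j i)"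
    by (subst sum.swap) (simp flip: assms)
  then show ?thesis
    by (simp add: sum_negf)
qed

text \<open>
  The edge \<open>{u, w}\<close> may cross \<open>S\<close> as well, but contributes nothing since \<open>x\<close> agrees at its ends.
\<close>

lemma sum_laplacian_mult_cut:
  fixes x :: "real^'v::finite"
  assumes G: "simple_graph G" and ab: "{a, b} \<in> G" "a \<in> S" "b \<notin> S"
    and xuw: "x $ u = x $ w"
    and cut: "\<And>c d. {c, d} \<in> G \<Longrightarrow> {c, d} \<noteq> {u, w} \<Longrightarrow> c \<in> S \<Longrightarrow> d \<notin> S \<Longrightarrow> {c, d} = {a, b}"
  shows "(\<Sum>i\<in>S. (laplacian G *v x) $ i) = x $ a - x $ b"
proof -
  define f where "f i j = (if {i, j} \<in> G then x $ i - x $ j else 0)" for i j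
  have out: "f i j = (if i = a then if j = b then x $ a - x $ b else 0 else 0)"
    if "i \<in> S" "j \<in> - S" for i j
  proof (cases "{i, j} = {u, w}")
    case True
    then have "x $ i = x $ j"
      using xuw by (auto simp: doubleton_eq_iff)
    then show ?thesis
      by (auto simp: f_def)
  next
    case False
    then show ?thesis
      using that ab cut[of i j] by (auto simp: f_def doubleton_eq_iff)
  qed
  have "(\<Sum>i\<in>S. (laplacian G *v x) $ i) = (\<Sum>i\<in>S. \<Sum>j\<in>S \<union> - S. f i j)"
    by (simp add: laplacian_mult_nth[OF G] f_def)
  also have "\<dots> = (\<Sum>i\<in>S. \<Sum>j\<in>S. f i j) + (\<Sum>i\<in>S. \<Sum>j\<in>- S. f i j)"
    by (subst sum.union_disjoint) (auto simp: sum.distrib)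
  \<comment> \<open>An edge inside \<open>S\<close> is counted from both ends with opposite
    signs.\<close>
  also have "(\<Sum>i\<in>S. \<Sum>j\<in>S. f i j) = 0"
    by (rule sum_antisymmetric) (simp add: f_def insert_commute)
  also have "(\<Sum>i\<in>S. \<Sum>j\<in>- S. f i j)
      = (\<Sum>i\<in>S. \<Sum>j\<in>- S. if i = a then if j = b then x $ a - x $ b else 0 else 0)"
    using out by (intro sum.cong) auto
  also have "\<dots> = (\<Sum>i\<in>S. if i = a then \<Sum>j\<in>- S. if j = b then x $ a - x $ b else 0 else 0)"
    by (intro sum.cong) auto
  also have "\<dots> = x $ a - x $ b"
    using ab by simp
  finally show ?thesis
    by simp
qed

text \<open>The second assumption on \<open>w\<close> says that \<open>uw\<close> is not a bridge.
  Vanishing at \<open>u\<close> starts the propagation; equal values at \<open>u\<close> and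
  \<open>w\<close> remove \<open>uw\<close> from all cut sums.\<close>

lemma unicyclic_eigenvector_2_eq_zero:
  fixes G :: "'v::finite graph" and x :: "real^'v"
  assumes G: "unicyclic G" and uw: "{u, w} \<in> G" "(w, u) \<in> (adj (G - {{u, w}}))\<^sup>*"
    and x: "laplacian G *v x = 2 *\<^sub>R x" "x $ u = 0" "x $ w = 0"
  shows "x = 0"
proof -
  let ?T = "G - {{u, w}}"
  have simple: "simple_graph G" and conn: "connected_graph G" and cardG: "card G = CARD('v)"
    using G by (auto simp: unicyclic_def)
  have connT: "connected_graph ?T"
    using conn uw(2) by (rule connected_graph_delete_edge)
  \<comment> \<open>Fewer edges than vertices, yet connected: every edge of \<open>?T\<close> is a
    bridge.\<close>
  have cardT: "card ?T < CARD('v)"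
    using cardG uw(1) by (metis card_Diff1_less finite)
  \<comment> \<open>The even integer combinations of the entries of \<open>x\<close>, a subgroup of
    the reals.\<close>
  define Q where "Q = {r. \<exists>m :: 'v \<Rightarrow> int. r = 2 * (\<Sum>j\<in>UNIV. of_int (m j) * x $ j)}"
  have Q_diff: "r - s \<in> Q" if r: "r \<in> Q" and s: "s \<in> Q" for r s
  proof -
    obtain m k :: "'v \<Rightarrow> int" where "r = 2 * (\<Sum>j\<in>UNIV. of_int (m j) * x $ j)"
      "s = 2 * (\<Sum>j\<in>UNIV. of_int (k j) * x $ j)"
      using r s by (auto simp: Q_def)
    then have "r - s = 2 * (\<Sum>j\<in>UNIV. of_int (m j - k j) * x $ j)"
      by (simp add: algebra_simps sum_subtractf)
    then show ?thesis
      unfolding Q_def by (intro CollectI exI[of _ "\<lambda>j. m j - k j"])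
  qed
  have edge: "x $ a - x $ b \<in> Q" if ab: "{a, b} \<in> ?T" for a b
  proof -
    obtain S where S: "a \<in> S" "b \<notin> S"
      and cut: "\<And>c d. {c, d} \<in> ?T \<Longrightarrow> c \<in> S \<Longrightarrow> d \<notin> S \<Longrightarrow> {c, d} = {a, b}"
      using bridge_if_connected_graph[OF connT cardT ab] by blast
    have "x $ a - x $ b = (\<Sum>i\<in>S. (laplacian G *v x) $ i)"
    proof (rule sum_laplacian_mult_cut[OF simple, symmetric])
      show "{a, b} \<in> G" "x $ u = x $ w"
        using ab x by simp_all
      show "{c, d} = {a, b}" if "{c, d} \<in> G" "{c, d} \<noteq> {u, w}" "c \<in> S" "d \<notin> S" for c d
        using that by (intro cut) simp_all
    qed (fact S)+
    \<comment> \<open>Here the eigenvalue 2 supplies the even factor; the coefficients are the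
      indicator of \<open>S\<close>.\<close>
    also have "\<dots> = 2 * (\<Sum>i\<in>S. x $ i)"
      by (simp add: x(1) sum_distrib_left)
    also have "(\<Sum>i\<in>S. x $ i) = (\<Sum>j\<in>UNIV. of_int (if j \<in> S then 1 else 0) * x $ j)"
      by (rule sum.mono_neutral_cong_left) auto
    finally show ?thesis
      unfolding Q_def by (intro CollectI exI[of _ "\<lambda>j. if j \<in> S then 1 else 0"])
  qed
  have "x $ i \<in> Q" for i
  proof -
    have "(u, i) \<in> (adj ?T)\<^sup>*"
      using connT by (simp add: connected_graph_def)
    then show ?thesis
    proof induction
      case base
      show ?case
        unfolding Q_def by (intro CollectI exI[of _ "\<lambda>_. 0"]) (simp add: x)
    next
      case (step y z)
      then have "x $ y - x $ z \<in> Q"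
        using edge[of y z] by (simp add: adj_def)
      then show ?case
        using Q_diff[OF step.IH] by fastforce
    qed
  qed
  then have "\<forall>i. \<exists>m :: 'v \<Rightarrow> int. x $ i = 2 * (\<Sum>j\<in>UNIV. of_int (m j) * x $ j)"
    by (simp add: Q_def)
  \<comment> \<open>The chosen coefficients become the rows of the matrix N.\<close>
  then obtain N :: "'v \<Rightarrow> 'v \<Rightarrow> int"
    where "\<And>i. x $ i = 2 * (\<Sum>j\<in>UNIV. of_int (N i j) * x $ j)"
    by metis
  then show ?thesis
    by (rule eq_zero_if_eq_double_integer_combination)
qed

section \<open>Dimension count\<close>

text \<open>Otherwise evaluation at \<open>w\<close> would be injective on the eigenspace, embedding
  dimension 2 into the real line.\<close>

lemma exists_unicyclic_eigenvector_2_nonzero_at: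
  fixes G :: "'v::finite graph"
  assumes G: "unicyclic G" and mult: "eig_mult G 2 = 2"
    and c: "is_cycle G c" "u \<in> set c"
  obtains x where "laplacian G *v x = 2 *\<^sub>R x" and "x $ u \<noteq> 0"
proof -
  let ?E = "{x. laplacian G *v x = 2 *\<^sub>R x}"
  obtain w where w: "{u, w} \<in> G" "(w, u) \<in> (adj (G - {{u, w}}))\<^sup>*"
    using is_cycle_delete_edge[OF c] by blast
  have "\<exists>x\<in>?E. x $ u \<noteq> 0"
  proof (rule ccontr)
    assume "\<not> ?thesis"
    then have zero: "x = 0" if "x \<in> ?E" "x $ w = 0" for x
      using unicyclic_eigenvector_2_eq_zero[OF G w, of x] that by auto
    have "subspace ?E"
      by (rule subspace_eigenspace)
    moreover have lin: "linear (\<lambda>x :: real^'v. x $ w)"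
      by (simp add: linear_iff)
    ultimately have "inj_on (\<lambda>x. x $ w) (span ?E)"
      using zero by (simp add: linear_inj_on_iff_eq_0 span_eq_iff[THEN iffD2])
    with lin have "dim ((\<lambda>x. x $ w) ` ?E) = dim ?E"
      by (metis dim_image_eq)
    then show False
      using mult dim_subset_UNIV[of "(\<lambda>x. x $ w) ` ?E"] by (simp add: eig_mult_def)
  qed
  then show thesis
    using that by auto
qed

lemma dim_kernel_functional:
  fixes W :: "'n::euclidean_space set" and f :: "'n \<Rightarrow> real"
  assumes W: "subspace W" and f: "linear f" and w: "w \<in> W" "f w \<noteq> 0"
  shows "dim W = dim {x \<in> W. f x = 0} + 1"
proof -
  let ?K = "{x \<in> W. f x = 0}"
  have sK: "subspace ?K"
    using subspace_inter[OF W linear_subspace_kernel[OF f]] by (simp add: Int_def)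
  have "W \<subseteq> span (insert w ?K)"
  proof
    fix x
    assume x: "x \<in> W"
    \<comment> \<open>Projection to the kernel along \<open>w\<close>: the multiple is chosen to
      cancel \<open>f x\<close>.\<close>
    have "x - (f x / f w) *\<^sub>R w \<in> ?K"
      using W x w by (simp add: subspace_diff subspace_scale linear_diff[OF f] linear_scale[OF f])
    then show "x \<in> span (insert w ?K)"
      by (meson span_base span_breakdown_eq)
  qed
  moreover have "span (insert w ?K) \<subseteq> W"
    using W w by (intro span_minimal) auto
  ultimately have "dim W = dim (insert w ?K)"
    by (metis dim_span subset_antisym)
  moreover have "w \<notin> span ?K"
    using sK w by (simp add: span_eq_iff[THEN iffD2])
  ultimately show ?thesis
    by (simp add: dim_insert)
qed

section \<open>Vectors and Laplacian of the one-edge connection\<close>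

definition join_vec :: "(real^'a) \<times> (real^'b) \<Rightarrow> real^('a::finite + 'b::finite)" where
  "join_vec p = (\<chi> k. case k of Inl i \<Rightarrow> fst p $ i | Inr j \<Rightarrow> snd p $ j)"

lemma join_vec_nth [simp]:
  "join_vec (x, y) $ Inl i = x $ i" "join_vec (x, y) $ Inr j = y $ j"
  by (simp_all add: join_vec_def)

lemma linear_join_vec: "linear join_vec"
  by (rule linearI) (auto simp: join_vec_def vec_eq_iff split: sum.split)

lemma inj_join_vec: "inj (join_vec :: (real^'a::finite) \<times> (real^'b::finite) \<Rightarrow> _)"
proof (rule injI)
  fix p q :: "(real^'a) \<times> (real^'b)"
  assume eq: "join_vec p = join_vec q"
  have "fst p $ i = fst q $ i" "snd p $ j = snd q $ j" for i j
    using arg_cong[OF eq, of "\<lambda>z. z $ Inl i"] arg_cong[OF eq, of "\<lambda>z. z $ Inr j"]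
    by (simp_all add: join_vec_def)
  then show "p = q"
    by (simp add: prod_eq_iff vec_eq_iff)
qed

lemma join_vec_cases: obtains x y where "z = join_vec (x, y)"
proof
  show "z = join_vec (\<chi> i. z $ Inl i, \<chi> j. z $ Inr j)"
    by (auto simp: join_vec_def vec_eq_iff split: sum.split)
qed

lemma one_edge_connection_iff [simp]:
  "{Inl i, Inl i'} \<in> one_edge_connection G u H v \<longleftrightarrow> {i, i'} \<in> G"
  "{Inr j, Inr j'} \<in> one_edge_connection G u H v \<longleftrightarrow> {j, j'} \<in> H"
  "{Inl i, Inr j} \<in> one_edge_connection G u H v \<longleftrightarrow> i = u \<and> j = v"
  "{Inr j, Inl i} \<in> one_edge_connection G u H v \<longleftrightarrow> i = u \<and> j = v"
proof -
  have l: "{Inl i, Inl i'} = Inl ` e \<longleftrightarrow> e = {i, i'}" for e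
    using inj_image_eq_iff[of Inl "{i, i'}" e] by auto
  have r: "{Inr j, Inr j'} = Inr ` e \<longleftrightarrow> e = {j, j'}" for e
    using inj_image_eq_iff[of Inr "{j, j'}" e] by auto
  show "{Inl i, Inl i'} \<in> one_edge_connection G u H v \<longleftrightarrow> {i, i'} \<in> G"
    "{Inr j, Inr j'} \<in> one_edge_connection G u H v \<longleftrightarrow> {j, j'} \<in> H"
    unfolding one_edge_connection_def by (auto simp: image_iff l r)
  show "{Inl i, Inr j} \<in> one_edge_connection G u H v \<longleftrightarrow> i = u \<and> j = v"
    "{Inr j, Inl i} \<in> one_edge_connection G u H v \<longleftrightarrow> i = u \<and> j = v"
    unfolding one_edge_connection_def by (auto simp: doubleton_eq_iff)
qed

lemma sum_UNIV_Plus: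
  fixes f :: "'a::finite + 'b::finite \<Rightarrow> 'c::comm_monoid_add"
  shows "(\<Sum>k\<in>UNIV. f k) = (\<Sum>i\<in>UNIV. f (Inl i)) + (\<Sum>j\<in>UNIV. f (Inr j))"
  unfolding UNIV_Plus_UNIV[symmetric] by (subst sum.Plus) auto

text \<open>The Laplacian is block diagonal except for the new edge, which adds the difference of
  its end values in row \<open>u\<close> and the negative in row \<open>v\<close>.\<close>

lemma laplacian_one_edge_connection:
  assumes "simple_graph G" and "simple_graph H"
  shows "laplacian (one_edge_connection G u H v) *v join_vec (x, y)
    = join_vec (laplacian G *v x + axis u (x $ u - y $ v), laplacian H *v y + axis v (y $ v - x $ u))"
    (is "?l = ?r")
proof -
  note S = simple_graph_one_edge_connection[OF assms]
  have *: "(\<Sum>j\<in>UNIV. if P \<and> j = a then f j else 0) = (if P then f a else 0)"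
    for P and a :: "'z::finite" and f :: "'z \<Rightarrow> real"
    by (cases P) auto
  have **: "(\<Sum>j\<in>UNIV. if j = a \<and> P then f j else 0) = (if P then f a else 0)"
    for P and a :: "'z::finite" and f :: "'z \<Rightarrow> real"
    by (cases P) auto
  have "?l $ k = ?r $ k" for k
    by (cases k)
      (auto simp: laplacian_mult_nth[OF S] laplacian_mult_nth[OF assms(1)] laplacian_mult_nth[OF assms(2)]
        sum_UNIV_Plus axis_def * ** cong: if_cong)
  then show ?thesis
    by (simp add: vec_eq_iff)
qed

section \<open>The eigenspace of the connection as a hyperplane\<close>

theorem theorem5:
  fixes G\<^sub>1 :: "'a::finite graph" and G\<^sub>2 :: "'b::finite graph"
    and c\<^sub>1 :: "'a list" and c\<^sub>2 :: "'b list" and u :: 'a and v :: 'b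
  assumes "unicyclic G\<^sub>1" and "unicyclic G\<^sub>2"
    and "\<exists>M. perfect_matching G\<^sub>1 M" and "\<exists>M. perfect_matching G\<^sub>2 M"
    and "eig_mult G\<^sub>1 2 = 2" and "eig_mult G\<^sub>2 2 = 2"
    and "is_cycle G\<^sub>1 c\<^sub>1" and "is_cycle G\<^sub>2 c\<^sub>2"
    and "u \<in> set c\<^sub>1" and "v \<in> set c\<^sub>2"
  shows "eig_mult (one_edge_connection G\<^sub>1 u G\<^sub>2 v) 2 = 3"
proof -
  let ?G = "one_edge_connection G\<^sub>1 u G\<^sub>2 v"
  let ?E1 = "{x. laplacian G\<^sub>1 *v x = 2 *\<^sub>R x}" and ?E2 = "{y. laplacian G\<^sub>2 *v y = 2 *\<^sub>R y}"
  let ?f = "\<lambda>p :: (real^'a) \<times> (real^'b). fst p $ u - snd p $ v"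
  let ?K = "{p \<in> ?E1 \<times> ?E2. ?f p = 0}"
  have simple: "simple_graph G\<^sub>1" "simple_graph G\<^sub>2"
    using assms(1,2) by (auto simp: unicyclic_def)
  \<comment> \<open>Used twice: as a test vector forcing equal values at \<open>u\<close> and
    \<open>v\<close>, and as a vector off the hyperplane.\<close>
  obtain x\<^sub>0 where x0: "laplacian G\<^sub>1 *v x\<^sub>0 = 2 *\<^sub>R x\<^sub>0" "x\<^sub>0 $ u \<noteq> 0"
    using exists_unicyclic_eigenvector_2_nonzero_at[OF assms(1,5,7,9)] by blast
  note L = laplacian_one_edge_connection[OF simple, of u v]
  have scale: "2 *\<^sub>R join_vec (x, y) = join_vec (2 *\<^sub>R x, 2 *\<^sub>R y)"
    for x :: "real^'a" and y :: "real^'b"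
    using linear_scale[OF linear_join_vec, of 2 "(x, y)"] by simp
  have eig_iff: "laplacian ?G *v join_vec (x, y) = 2 *\<^sub>R join_vec (x, y) \<longleftrightarrow> (x, y) \<in> ?K" for x y
  proof
    assume "laplacian ?G *v join_vec (x, y) = 2 *\<^sub>R join_vec (x, y)"
    then have x: "laplacian G\<^sub>1 *v x + axis u (x $ u - y $ v) = 2 *\<^sub>R x"
      and y: "laplacian G\<^sub>2 *v y + axis v (y $ v - x $ u) = 2 *\<^sub>R y"
      unfolding L scale by (auto dest: injD[OF inj_join_vec])
    \<comment> \<open>Symmetry moves the Laplacian onto the eigenvector \<open>x\<^sub>0\<close>;
      comparison with the paired equation for \<open>x\<close> leaves only the contribution of the
      new edge, which must be 0.\<close>
    have "x\<^sub>0 \<bullet> (laplacian G\<^sub>1 *v x) = 2 * (x\<^sub>0 \<bullet> x)"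
      by (metis x0(1) dot_lmul_matrix inner_scaleR_left transpose_laplacian vector_transpose_matrix)
    moreover have "x\<^sub>0 \<bullet> (laplacian G\<^sub>1 *v x) + x\<^sub>0 $ u * (x $ u - y $ v) = 2 * (x\<^sub>0 \<bullet> x)"
      using arg_cong[OF x, of "inner x\<^sub>0"] by (simp add: inner_add_right inner_axis)
    ultimately have "x $ u = y $ v"
      using x0(2) by simp
    then show "(x, y) \<in> ?K"
      using x y by (simp add: axis_def zero_vec_def[symmetric])
  next
    assume "(x, y) \<in> ?K"
    then show "laplacian ?G *v join_vec (x, y) = 2 *\<^sub>R join_vec (x, y)"
      unfolding L scale by (simp add: axis_def zero_vec_def[symmetric])
  qed
  have "{z. laplacian ?G *v z = 2 *\<^sub>R z} = join_vec ` ?K"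
  proof (intro set_eqI)
    fix z :: "real^('a + 'b)"
    obtain x :: "real^'a" and y :: "real^'b" where z: "z = join_vec (x, y)"
      by (rule join_vec_cases)
    show "z \<in> {z. laplacian ?G *v z = 2 *\<^sub>R z} \<longleftrightarrow> z \<in> join_vec ` ?K"
      unfolding z inj_image_mem_iff[OF inj_join_vec] using eig_iff by simp
  qed
  then have "eig_mult ?G 2 = dim (join_vec ` ?K)"
    by (simp add: eig_mult_def)
  also have "\<dots> = dim ?K"
    by (rule dim_image_eq[OF linear_join_vec]) (rule inj_on_subset[OF inj_join_vec subset_UNIV])
  also have "\<dots> = 3"
  proof -
    have "linear ?f"
      by (rule linearI) (auto simp: algebra_simps)
    moreover have "subspace (?E1 \<times> ?E2)"
      by (intro subspace_Times subspace_eigenspace)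
    \<comment> \<open>So \<open>?f\<close> is nonzero on the product and its kernel loses exactly
      one dimension.\<close>
    moreover have "(x\<^sub>0, 0) \<in> ?E1 \<times> ?E2" "?f (x\<^sub>0, 0) \<noteq> 0"
      using x0 by auto
    ultimately have "dim (?E1 \<times> ?E2) = dim ?K + 1"
      by (intro dim_kernel_functional)
    moreover have "dim (?E1 \<times> ?E2) = 4"
      using assms(5,6) by (simp add: dim_Times subspace_eigenspace eig_mult_def)
    ultimately show ?thesis
      by simp
  qed
  finally show ?thesis .
qed

end
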